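(* Let $k>0$ and $t\ge 2$ be integers. Let $G=(V,E)$ be a graph on more than $k$ vertices, satisfying $$|N_G(W)|\ge t\quad\text{for every } W\subset V \text{ with } \frac{k}{2}\le |W|\le k.$$ Then $G$ contains a cycle of length at least $t+1$.
   Context: Graphs are finite and simple. For a graph $G=(V,E)$ and $W\subset V$, $N_G(W)=\{v\in V\setminus W: v \text{ has a neighbor in } W\}$ denotes the external neighborhood of $W$ in $G$. The length of a cycle is its number of edges. *)

theory Defs
  imports Complex_Main "Graph_Theory.Graph_Theory"
begin

(* A finite simple graph is a pair_graph: a finite, loop-free digraph with symmetric
   arc relation parcs G, in which an undirected edge uv is the pair of arcs (u,v), (v,u). *)

definition ext_nbhd :: "'a pair_pre_digraph \<Rightarrow> 'a set \<Rightarrow> 'a set" where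
  "ext_nbhd G W = {v \<in> pverts G - W. \<exists>w\<in>W. (v, w) \<in> parcs G}"

(* The library's digraph notion of cycle admits the closed walk u, v, u of length 2 in a
   symmetric digraph.  Excluding length 2 leaves exactly the cycles of the underlying simple
   graph, each presented as the list of arcs traversed; its length is the number of edges. *)
definition graph_cycle :: "'a pair_pre_digraph \<Rightarrow> ('a \<times> 'a) list \<Rightarrow> bool" where
  "graph_cycle G p \<longleftrightarrow> pre_digraph.cycle (with_proj G) p \<and> length p \<ge> 3"

end

theory Submission
  imports Defs
begin

text \<open>
  The proof imitates a depth-first search, but keeps only the stack of the search, not its tree.
  A state of the search consists of a path \<open>P\<close> (the stack) and a set \<open>C\<close> of at least \<open>k\<close>
  vertices off \<open>P\<close>, such that all neighbours of \<open>C\<close> outside \<open>C\<close> lie on \<open>P\<close>, and every vertex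
  of \<open>C\<close> is the end of a path that extends \<open>P\<close> inside \<open>C\<close>.  The empty path together with the
  whole vertex set is such a state.

  If some component \<open>D\<close> of the graph induced on \<open>C\<close> has more than \<open>k\<close> vertices, the search
  enters \<open>D\<close>: a vertex \<open>u\<close> of \<open>D\<close> that extends the path \<open>P\<close> is pushed onto the stack,
  and \<open>D - {u}\<close> replaces \<open>C\<close>.  As \<open>C\<close> shrinks, this can happen only finitely often.

  Otherwise every component has at most \<open>k\<close> vertices, while all of them together have at least
  \<open>k\<close>; then some union \<open>W\<close> of components has between \<open>k/2\<close> and \<open>k\<close> vertices
  (\<open>closed_in_card_between\<close>).  The neighbours of \<open>W\<close> all lie on \<open>P\<close>, and there are at least
  \<open>t\<close> of them by hypothesis, so the neighbour \<open>x\<close> that comes first on \<open>P\<close> is followed by at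
  least \<open>t - 1\<close> further vertices of \<open>P\<close>.  Going along \<open>P\<close> from \<open>x\<close> to its end, on through
  \<open>C\<close> to a neighbour of \<open>x\<close> in \<open>W\<close>, and back to \<open>x\<close> gives a cycle with at least \<open>t + 1\<close>
  vertices (\<open>cycle_through_far_neighbour\<close>).
\<close>

section \<open>Paths and components inside a vertex set\<close>

definition is_path :: "'a rel \<Rightarrow> 'a list \<Rightarrow> bool" where
  "is_path E xs \<longleftrightarrow> distinct xs \<and> successively (\<lambda>u v. (u, v) \<in> E) xs"

text \<open>
  For a symmetric relation these are the unions of components of the graph induced on \<open>C\<close>.
\<close>
definition closed_in :: "'a rel \<Rightarrow> 'a set \<Rightarrow> 'a set \<Rightarrow> bool" where
  "closed_in E C W \<longleftrightarrow> W \<subseteq> C \<and> (\<forall>w\<in>W. \<forall>d\<in>C. (w, d) \<in> E \<longrightarrow> d \<in> W)"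

definition component :: "'a rel \<Rightarrow> 'a set \<Rightarrow> 'a \<Rightarrow> 'a set" where
  "component E C c = {d. (c, d) \<in> (E \<inter> C \<times> C)\<^sup>*}"

lemma component_self: "c \<in> component E C c"
  by (simp add: component_def)

lemma component_subset: "c \<in> C \<Longrightarrow> component E C c \<subseteq> C"
  unfolding component_def by (auto elim: rtranclE)

lemma component_mono: "d \<in> component E C c \<Longrightarrow> component E C d \<subseteq> component E C c"
  unfolding component_def by auto

lemma closed_in_component:
  assumes "c \<in> C"
  shows "closed_in E C (component E C c)"
  unfolding closed_in_def
proof (intro conjI ballI impI)
  fix w d assume w: "w \<in> component E C c" and "d \<in> C" "(w, d) \<in> E"
  moreover have "w \<in> C" using w component_subset[OF assms] by blast
  ultimately show "d \<in> component E C c"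
    unfolding component_def by (auto intro: rtrancl_into_rtrancl)
qed (rule component_subset[OF assms])

lemma closed_in_Un: "closed_in E C W \<Longrightarrow> closed_in E C W' \<Longrightarrow> closed_in E C (W \<union> W')"
  unfolding closed_in_def by blast

text \<open>
  Symmetry matters here: a walk from outside \<open>W\<close> that entered \<open>W\<close> could be reversed, and would
  then leave \<open>W\<close>.
\<close>
lemma component_disjoint_closed_in:
  assumes "sym E" "closed_in E C W" "c \<notin> W"
  shows "component E C c \<inter> W = {}"
proof -
  have "d \<notin> W" if "(c, d) \<in> (E \<inter> C \<times> C)\<^sup>*" for d
    using that
  proof induction
    case (step d e)
    then show ?case using assms(1,2) unfolding closed_in_def by (auto dest: symD)
  qed (rule assms(3))
  then show ?thesis by (auto simp: component_def)
qed

lemma last_path_in_component: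
  assumes "is_path E Q" "Q \<noteq> []" "set Q \<subseteq> C"
  shows "last Q \<in> component E C (hd Q)"
  using assms
proof (induction Q rule: induct_list012)
  case (3 x y zs)
  then have "last (y # zs) \<in> component E C y" and "(x, y) \<in> E \<inter> C \<times> C"
    by (auto simp: is_path_def)
  then show ?case
    by (auto simp: component_def intro: converse_rtrancl_into_rtrancl)
qed (auto simp: component_self)

text \<open>
  A walk that returns to a vertex of the path built so far is cut back to that vertex.
\<close>
lemma path_within_component:
  assumes "d \<in> component E C c"
  shows "\<exists>Q. is_path E (c # Q) \<and> last (c # Q) = d \<and> set (c # Q) \<subseteq> component E C c"
proof -
  have "(c, d) \<in> (E \<inter> C \<times> C)\<^sup>*" using assms by (simp add: component_def)
  then show ?thesis
  proof induction
    case base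
    show ?case by (intro exI[of _ "[]"]) (simp add: is_path_def component_self)
  next
    case (step d e)
    then obtain Q where Q: "is_path E (c # Q)" "last (c # Q) = d"
        "set (c # Q) \<subseteq> component E C c" by blast
    have e: "e \<in> component E C c"
      using step.hyps by (auto simp: component_def intro: rtrancl_into_rtrancl)
    show ?case
    proof (cases "e \<in> set (c # Q)")
      case True
      then obtain ys zs where split: "c # Q = (ys @ [e]) @ zs"
        by (metis split_list append.assoc append_Cons append_Nil)
      then have "is_path E (ys @ [e])"
        using Q(1) unfolding is_path_def by (metis distinct_append successively_append_iff)
      moreover have "set (ys @ [e]) \<subseteq> component E C c"
        using Q(3) split by (metis Un_subset_iff set_append)
      moreover obtain Q' where "ys @ [e] = c # Q'"
        using split by (cases ys) auto
      ultimately show ?thesis by (metis last_snoc)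
    next
      case False
      have "is_path E ((c # Q) @ [e])"
        using Q(1,2) False step.hyps(2) unfolding is_path_def successively_append_iff by auto
      then show ?thesis
        using Q(3) e by (intro exI[of _ "Q @ [e]"]) auto
    qed
  qed
qed

text \<open>
  Take \<open>W\<close> of maximal cardinality among the closed sets with at most \<open>k\<close> elements.  Were it
  smaller than \<open>k/2\<close>, adding any missing component would exceed \<open>k\<close> by maximality, so this
  component alone would have more than \<open>k/2\<close> elements, and would itself be a closed set with at
  most \<open>k\<close> elements that is larger than \<open>W\<close>.
\<close>
lemma closed_in_card_between:
  assumes "sym E" "finite C" "0 < k" "k \<le> card C"
    and small: "\<And>c. c \<in> C \<Longrightarrow> card (component E C c) \<le> k"
  shows "\<exists>W. closed_in E C W \<and> real k / 2 \<le> real (card W) \<and> card W \<le> k"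
proof -
  let ?P = "\<lambda>W. closed_in E C W \<and> card W \<le> k"
  have "?P {}" by (simp add: closed_in_def)
  then obtain W where W: "?P W" and max: "\<And>W'. ?P W' \<Longrightarrow> card W' \<le> card W"
    using ex_has_greatest_nat[of ?P "{}" card "Suc k"] by (auto simp: less_Suc_eq_le)
  have WC: "W \<subseteq> C" using W by (simp add: closed_in_def)
  have "real k / 2 \<le> real (card W)"
  proof (rule ccontr)
    assume "\<not> real k / 2 \<le> real (card W)"
    then have half: "2 * card W < k" by linarith
    then have "W \<noteq> C" using assms(4) by auto
    then obtain c where c: "c \<in> C" "c \<notin> W" using WC by blast
    let ?R = "component E C c"
    have R: "closed_in E C ?R" "card ?R \<le> k"
      using closed_in_component c(1) small by auto
    have fin: "finite W" "finite ?R"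
      using WC component_subset[OF c(1)] assms(2) by (auto intro: finite_subset)
    have card_Un: "card (W \<union> ?R) = card W + card ?R"
      using card_Un_disjoint[OF fin] component_disjoint_closed_in[OF assms(1) _ c(2)] W by blast
    have "card ?R > 0" using component_self fin(2) by (metis card_gt_0_iff empty_iff)
    then have "\<not> card (W \<union> ?R) \<le> k"
      using max[of "W \<union> ?R"] closed_in_Un[of E C W ?R] W R(1) card_Un by linarith
    then show False using max[of ?R] R half card_Un by linarith
  qed
  then show ?thesis using W by blast
qed

section \<open>Cycles from vertex lists\<close>

lemma pcas_vwalk_arcs: "pcas y (vwalk_arcs (y # zs)) (last (y # zs))"
  by (induction zs arbitrary: y) auto

lemma pawalk_verts_vwalk_arcs: "pawalk_verts y (vwalk_arcs (y # zs)) = y # zs"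
  by (induction zs arbitrary: y) auto

lemma vwalk_arcs_subset_iff_successively:
  "set (vwalk_arcs xs) \<subseteq> E \<longleftrightarrow> successively (\<lambda>u v. (u, v) \<in> E) xs"
  by (induction xs rule: induct_list012) auto

lemma (in pair_wf_digraph) graph_cycle_of_closed_path:
  assumes "is_path (parcs G) ys" "length ys \<ge> 3" "(last ys, hd ys) \<in> parcs G"
  shows "graph_cycle G (vwalk_arcs (ys @ [hd ys]))"
    and "length (vwalk_arcs (ys @ [hd ys])) = length ys"
proof -
  let ?p = "vwalk_arcs (ys @ [hd ys])"
  obtain y zs where ys: "ys = y # zs" using assms(2) by (cases ys) auto
  show len: "length ?p = length ys"
    by (simp flip: vwalk_length_def)
  have arcs: "set ?p \<subseteq> parcs G"
    using assms(1,3) unfolding vwalk_arcs_subset_iff_successively is_path_def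
      successively_append_iff by simp
  have cas: "pcas y ?p y"
    using pcas_vwalk_arcs[of y "zs @ [y]"] ys by simp
  have verts: "pawalk_verts y ?p = y # zs @ [y]"
    using pawalk_verts_vwalk_arcs[of y "zs @ [y]"] ys by simp
  have "y \<in> pverts G" using assms(3) ys in_arcsD2 by auto
  then have "awalk y ?p y" using arcs cas by (simp add: awalk_def)
  moreover have "distinct (tl (pawalk_verts y ?p))"
    using assms(1) ys verts by (auto simp: is_path_def)
  moreover have "?p \<noteq> []" using len ys by auto
  ultimately have "cycle ?p" unfolding cycle_def by blast
  then show "graph_cycle G ?p"
    unfolding graph_cycle_def using len assms(2) by simp
qed

section \<open>The search\<close>

text \<open>
  The first vertex of \<open>P\<close> in the neighbourhood of \<open>W\<close> starts a final segment of \<open>P\<close> that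
  contains the whole neighbourhood, hence has at least \<open>t\<close> vertices; the detour to \<open>W\<close> that
  closes the cycle contributes at least one more.
\<close>
lemma (in pair_graph) cycle_through_far_neighbour:
  assumes "t \<ge> 2" "t \<le> card (ext_nbhd G W)"
    and nbhd: "ext_nbhd G W \<subseteq> set P"
    and reach: "\<And>w. w \<in> W \<Longrightarrow> \<exists>Q. Q \<noteq> [] \<and> last Q = w \<and> is_path (parcs G) (P @ Q)"
  shows "\<exists>p. graph_cycle G p \<and> length p \<ge> t + 1"
proof -
  let ?N = "ext_nbhd G W"
  have "?N \<noteq> {}" using assms(1,2) by auto
  then have "\<exists>x\<in>set P. x \<in> ?N" using nbhd by blast
  then obtain A x B where P: "P = A @ x # B" "x \<in> ?N" "\<forall>a\<in>set A. a \<notin> ?N"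
    using split_list_first_prop[of P "\<lambda>x. x \<in> ?N"] by blast
  have "?N \<subseteq> set (x # B)" using nbhd P by auto
  then have "card ?N \<le> card (set (x # B))" by (simp add: card_mono)
  also have "\<dots> \<le> length (x # B)" by (rule card_length)
  finally have len: "t \<le> length (x # B)" using assms(2) by linarith
  obtain w where w: "w \<in> W" "(x, w) \<in> parcs G" using P(2) by (auto simp: ext_nbhd_def)
  obtain Q where Q: "Q \<noteq> []" "last Q = w" "is_path (parcs G) (P @ Q)"
    using reach[OF w(1)] by blast
  let ?ys = "(x # B) @ Q"
  have ys: "is_path (parcs G) ?ys"
    using Q(3) P(1) unfolding is_path_def by (auto simp: successively_append_iff)
  have "length Q \<ge> 1" using Q(1) by (simp add: Suc_le_eq)
  then have l: "length ?ys \<ge> t + 1" using len unfolding length_append by linarith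
  have closing: "(last ?ys, hd ?ys) \<in> parcs G"
    using Q(1,2) w(2) arcs_symmetric by simp
  have "length ?ys \<ge> 3" using l assms(1) by linarith
  from graph_cycle_of_closed_path[OF ys this closing] l show ?thesis by metis
qed

text \<open>
  The last hypothesis stands for the connection between the stack and the unexplored part: it
  makes the end of a nonempty \<open>P\<close> adjacent to the first vertex of each \<open>Q\<close>, and for the empty
  stack it holds trivially with one-vertex paths.  So the start of the search needs no separate treatment,
  although the graph may be disconnected.
\<close>
lemma (in pair_graph) long_cycle_of_search_state:
  assumes "k > 0" "t \<ge> 2"
    and expand: "\<And>W. W \<subseteq> pverts G \<Longrightarrow> real k / 2 \<le> real (card W) \<Longrightarrow> card W \<le> k
           \<Longrightarrow> card (ext_nbhd G W) \<ge> t"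
    and "C \<subseteq> pverts G" "k \<le> card C" "C \<inter> set P = {}" "ext_nbhd G C \<subseteq> set P"
    and "\<And>c. c \<in> C \<Longrightarrow> \<exists>Q. Q \<noteq> [] \<and> set Q \<subseteq> C \<and> last Q = c \<and> is_path (parcs G) (P @ Q)"
  shows "\<exists>p. graph_cycle G p \<and> length p \<ge> t + 1"
  using assms(4-)
proof (induction "card C" arbitrary: C P rule: less_induct)
  case less
  note CV = less.prems(1) and big = less.prems(2) and disj = less.prems(3)
    and nbhd = less.prems(4) and reach = less.prems(5)
  let ?E = "parcs G"
  have finC: "finite C" using CV pair_finite_verts finite_subset by blast
  have symE: "sym ?E" by (auto intro: symI arcs_symmetric)
  have nbhd_closed: "ext_nbhd G W \<subseteq> set P" if W: "closed_in ?E C W" for W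
  proof
    fix v assume "v \<in> ext_nbhd G W"
    then obtain w where v: "v \<in> pverts G" "v \<notin> W" "w \<in> W" "(v, w) \<in> ?E"
      by (auto simp: ext_nbhd_def)
    have "v \<notin> C" using v W arcs_symmetric unfolding closed_in_def by blast
    moreover have "w \<in> C" using v(3) W unfolding closed_in_def by blast
    ultimately have "v \<in> ext_nbhd G C" using v by (auto simp: ext_nbhd_def)
    then show "v \<in> set P" using nbhd by blast
  qed
  show ?case
  proof (cases "\<exists>c\<in>C. k < card (component ?E C c)")
    case True
    then obtain c where c: "c \<in> C" "k < card (component ?E C c)" by blast
    obtain Q where Q: "Q \<noteq> []" "set Q \<subseteq> C" "last Q = c" "is_path ?E (P @ Q)"
      using reach[OF c(1)] by blast
    \<comment> \<open>Pushing \<open>c\<close> itself need not extend the path \<open>P\<close>; the first vertex of \<open>Q\<close> does, and it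
      lies in the same component.\<close>
    define u where "u = hd Q"
    define D where "D = component ?E C u"
    have uC: "u \<in> C" using Q(1,2) u_def by auto
    have DC: "D \<subseteq> C" unfolding D_def by (rule component_subset[OF uC])
    have finD: "finite D" using DC finC finite_subset by blast
    have uD: "u \<in> D" by (simp add: D_def component_self)
    have "is_path ?E Q" using Q(4) by (simp add: is_path_def successively_append_iff)
    then have "c \<in> D" using last_path_in_component Q(1,2,3) unfolding D_def u_def by metis
    then have "component ?E C c \<subseteq> D" unfolding D_def by (rule component_mono)
    then have "k < card D" using c(2) card_mono[OF finD] by (meson less_le_trans)
    have Pu: "is_path ?E (P @ [u])"
      using Q(1,4) unfolding u_def is_path_def by (cases Q) (auto simp: successively_append_iff)
    let ?C = "D - {u}"
    show ?thesis
    proof (rule less.hyps[of ?C "P @ [u]"])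
      show "card ?C < card C"
        using DC uC finC by (intro psubset_card_mono) auto
      show "?C \<subseteq> pverts G" using DC CV by blast
      show "k \<le> card ?C" using \<open>k < card D\<close> uD finD by (simp add: card_Diff_singleton)
      show "?C \<inter> set (P @ [u]) = {}" using DC disj by auto
      have "ext_nbhd G ?C \<subseteq> insert u (ext_nbhd G D)" by (auto simp: ext_nbhd_def)
      then show "ext_nbhd G ?C \<subseteq> set (P @ [u])"
        using nbhd_closed[of D] closed_in_component[OF uC] unfolding D_def by auto
    next
      fix d assume d: "d \<in> ?C"
      then obtain R where R: "is_path ?E (u # R)" "last (u # R) = d" "set (u # R) \<subseteq> D"
        using path_within_component unfolding D_def by (metis DiffD1)
      have "R \<noteq> []" using R(2) d by auto
      moreover have "set R \<subseteq> ?C" using R(1,3) by (auto simp: is_path_def)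
      moreover have "is_path ?E ((P @ [u]) @ R)"
        using Pu R(1,3) disj DC unfolding is_path_def
        by (auto simp: successively_append_iff successively_Cons)
      ultimately show "\<exists>R. R \<noteq> [] \<and> set R \<subseteq> ?C \<and> last R = d \<and> is_path ?E ((P @ [u]) @ R)"
        using R(2) by auto
    qed
  next
    case False
    then obtain W where W: "closed_in ?E C W" "real k / 2 \<le> real (card W)" "card W \<le> k"
      using closed_in_card_between[OF symE finC assms(1) big] by (meson not_less)
    have "W \<subseteq> C" using W(1) by (simp add: closed_in_def)
    show ?thesis
    proof (rule cycle_through_far_neighbour[OF assms(2) _ nbhd_closed[OF W(1)]])
      show "t \<le> card (ext_nbhd G W)" using expand W(2,3) \<open>W \<subseteq> C\<close> CV by blast
      show "\<exists>Q. Q \<noteq> [] \<and> last Q = w \<and> is_path ?E (P @ Q)" if "w \<in> W" for w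
        using reach[of w] that \<open>W \<subseteq> C\<close> by blast
    qed
  qed
qed

theorem theorem1:
  fixes G :: "'a pair_pre_digraph" and k t :: nat
  assumes "pair_graph G"
    and "k > 0"
    and "t \<ge> 2"
    and "card (pverts G) > k"
    and "\<And>W. W \<subseteq> pverts G \<Longrightarrow> real k / 2 \<le> real (card W) \<Longrightarrow> card W \<le> k
           \<Longrightarrow> card (ext_nbhd G W) \<ge> t"
  shows "\<exists>p. graph_cycle G p \<and> length p \<ge> t + 1"
proof -
  interpret pair_graph G by fact
  show ?thesis
  proof (rule long_cycle_of_search_state[OF assms(2,3,5), where C = "pverts G" and P = "[]"])
    show "\<exists>Q. Q \<noteq> [] \<and> set Q \<subseteq> pverts G \<and> last Q = c \<and> is_path (parcs G) ([] @ Q)"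
      if "c \<in> pverts G" for c
      using that by (intro exI[of _ "[c]"]) (simp add: is_path_def)
  qed (use assms(4) in \<open>auto simp: ext_nbhd_def\<close>)
qed

end
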